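(* Let $m,n\in\mathbb{N}$ and $a,b\in\mathbb{Z}$ with $a\neq0$ and $b\neq0$. Then for all $x,y,z\in\mathbb{R}$, \begin{align*} &m\,a\,\overline{B}_{m-1}(ax+y)\overline{B}_{n}(bx+z)+n\,b\,\overline{B}_{m}(ax+y)\overline{B}_{n-1}(bx+z)\\ &=n\,b^{n-1}\mathrm{sgn}(b)\sum_{j=0}^{m}\binom{m}{j}(-1)^{j}a^{m-j}\sum_{l=1}^{|b|}\overline{B}_{j}\Bigl(\frac{a(l+z)}{b}-y\Bigr)\overline{B}_{m+n-j-1}\Bigl(x+\frac{l+z}{b}\Bigr)\\ &\quad+m\,a^{m-1}\mathrm{sgn}(a)\sum_{j=0}^{n}\binom{n}{j}(-1)^{j}b^{n-j}\sum_{l=1}^{|a|}\overline{B}_{j}\Bigl(\frac{b(l+y)}{a}-z\Bigr)\overline{B}_{m+n-j-1}\Bigl(x+\frac{l+y}{a}\Bigr)\\ &\quad-\mathrm{sgn}(ab)\,\delta_{\mathbb{Z}}(ax+y)\,\delta_{\mathbb{Z}}(bx+z)\,\frac{\delta_{1,m-1}\delta_{1,n}\,m a+\delta_{1,m}\delta_{1,n-1}\,n b}{4}. \end{align*}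
   Context: $\{x\}$ denotes the fractional part of $x$; $B_n(x)$ is the $n$-th Bernoulli polynomial. Bernoulli functions: $\overline{B}_{0}(x)=1$; $\overline{B}_{1}(x)=\{x\}-\frac12$ for $x\notin\mathbb{Z}$ and $0$ for $x\in\mathbb{Z}$; $\overline{B}_{n}(x)=B_{n}(\{x\})$ for $n\ge2$. $\delta_{\mathbb{Z}}(x)=1$ if $x\in\mathbb{Z}$, $0$ otherwise; $\delta_{l,k}$ is the Kronecker delta; $\mathrm{sgn}$ is the sign function ($\mathrm{sgn}(0)=0$). *)

theory Defs
  imports Complex_Main "HOL-Computational_Algebra.Formal_Power_Series"
begin

text \<open>
  Bernoulli polynomials, via \<open>t exp(x t) / (exp t - 1) = (\<Sum>n. B\<^sub>n(x) t\<^sup>n / n!)\<close>.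
\<close>

definition bernpoly :: "nat \<Rightarrow> real \<Rightarrow> real" where
  "bernpoly n x = fact n * fps_nth (fps_X * fps_exp x / (fps_exp 1 - 1)) n"

definition bernfun :: "nat \<Rightarrow> real \<Rightarrow> real" where
  "bernfun n x =
     (if n = 0 then 1
      else if n = 1 then (if x \<in> \<int> then 0 else frac x - 1 / 2)
      else bernpoly n (frac x))"

definition delta_Ints :: "real \<Rightarrow> real" where
  "delta_Ints x = (if x \<in> \<int> then 1 else 0)"

definition kronecker :: "nat \<Rightarrow> nat \<Rightarrow> real" where
  "kronecker l k = (if l = k then 1 else 0)"

text \<open>
  The division above is exact, even though the denominator is not a unit of the
  ring of formal power series.
\<close>

lemma bernpoly_generating_function:
  "Abs_fps (\<lambda>n. bernpoly n x / fact n) * (fps_exp 1 - 1) = fps_X * fps_exp x"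
proof -
  have nz: "fps_nth (fps_exp 1 - 1 :: real fps) 1 \<noteq> 0"
    by simp
  then have "fps_exp 1 - 1 \<noteq> (0 :: real fps)"
    by (metis fps_zero_nth)
  moreover have "subdegree (fps_exp 1 - 1 :: real fps) = 1"
    by (rule subdegreeI) auto
  ultimately have "fps_exp 1 - 1 dvd (fps_X * fps_exp x :: real fps)"
    by (subst fps_dvd_iff) (auto simp: subdegree_mult)
  moreover have "Abs_fps (\<lambda>n. bernpoly n x / fact n) = fps_X * fps_exp x / (fps_exp 1 - 1)"
    by (rule fps_ext) (simp add: bernpoly_def)
  ultimately show ?thesis
    by (metis dvd_div_mult_self)
qed

end

theory Submission
  imports Defs "HOL-Computational_Algebra.Polynomial"
begin

text \<open>
  Write \<open>G\<^sub>c(x)\<close> for the exponential generating function of the Bernoulli functions at \<open>x\<close> in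
  the variable \<open>c t\<close>. For small \<open>h \<noteq> 0\<close> one has
  \<open>G\<^sub>c(x + h) = exp(c h t) (G\<^sub>c(x) - sgn(h) \<delta>(x) c t / 2)\<close>, where \<open>\<delta>\<close> is the indicator
  of the integers. In generating function form, with \<open>w = a u + b v\<close>, the difference \<open>D(x)\<close> of
  both sides is built so that all jump terms cancel, which leaves \<open>D(x + h) = exp(w h t) D(x)\<close> for
  small \<open>h\<close>. Hence \<open>exp(- w x t) D(x)\<close> is locally constant, so constant; since \<open>D\<close> has period 1,
  \<open>D = 0\<close> whenever \<open>w \<noteq> 0\<close>. Setting \<open>v = 1\<close>, the coefficient of \<open>t\<^bsup>m+n-1\<^esup>\<close> is a polynomial in
  \<open>u\<close> vanishing at all but one point, and its coefficient at \<open>u\<^bsup>m\<^esup>\<close> is the theorem.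
\<close>

section \<open>Generating functions of Bernoulli polynomials\<close>

text \<open>This is \<open>c t exp(c x t) / (exp(c t) - 1)\<close>. Defining it by coefficients
  covers \<open>c = 0\<close> as well, where the quotient reads 0/0 and the series is 1.\<close>

definition bernpoly_fps :: "real \<Rightarrow> real \<Rightarrow> real fps" where
  "bernpoly_fps c x = Abs_fps (\<lambda>n. bernpoly n x / fact n * c ^ n)"

definition bernfps :: "real \<Rightarrow> real \<Rightarrow> real fps" where
  "bernfps c x = Abs_fps (\<lambda>n. bernfun n x / fact n * c ^ n)"

text \<open>Substitute \<open>c t\<close> for \<open>t\<close> in
  \<open>bernpoly_generating_function\<close>.\<close>

lemma bernpoly_fps_mult_exp:
  "bernpoly_fps c x * (fps_exp c - 1) = fps_const c * fps_X * fps_exp (c * x)"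
proof -
  have X: "fps_nth (fps_const c * fps_X) 0 = 0" by simp
  have "bernpoly_fps c x = Abs_fps (\<lambda>n. bernpoly n x / fact n) oo (fps_const c * fps_X)"
    by (simp add: bernpoly_fps_def fps_compose_linear mult.commute[of "c ^ _"])
  moreover have "(fps_exp 1 - 1) oo (fps_const c * fps_X) = fps_exp c - (1 :: real fps)"
    by (simp add: fps_compose_sub_distrib)
  ultimately have "bernpoly_fps c x * (fps_exp c - 1) = (fps_X * fps_exp x) oo (fps_const c * fps_X)"
    by (metis X bernpoly_generating_function fps_compose_mult_distrib)
  also have "\<dots> = fps_const c * fps_X * fps_exp (c * x)"
    by (simp add: fps_compose_mult_distrib)
  finally show ?thesis .
qed

lemma fps_exp_eq_one_iff: "fps_exp c = (1 :: real fps) \<longleftrightarrow> c = 0"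
  by (metis fps_exp_0 fps_exp_eq_iff)

text \<open>Real power series form an integral domain. For \<open>c \<noteq> 0\<close> this reduces
  identities between the series \<open>bernpoly_fps c x\<close> to identities between
  exponentials.\<close>

lemma fps_exp_minus_1_cancel:
  assumes "c \<noteq> 0" "f * (fps_exp c - 1) = g * (fps_exp c - (1 :: real fps))"
  shows "f = g"
  using assms by (simp add: fps_exp_eq_one_iff)

lemma bernpoly_zero: "bernpoly 0 x = 1"
proof -
  have "fps_nth (bernpoly_fps 1 x * (fps_exp 1 - 1)) 1 = 1"
    unfolding bernpoly_fps_mult_exp by simp
  then show ?thesis
    by (simp add: fps_mult_nth_1 bernpoly_fps_def)
qed

lemma bernpoly_fps_zero: "bernpoly_fps 0 x = 1"
  by (rule fps_ext) (simp add: bernpoly_fps_def power_0_left bernpoly_zero)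

lemma bernpoly_fps_shift: "bernpoly_fps c (x + h) = fps_exp (c * h) * bernpoly_fps c x"
proof (cases "c = 0")
  case False
  then show ?thesis
    by (rule fps_exp_minus_1_cancel)
      (simp only: bernpoly_fps_mult_exp mult.assoc distrib_left fps_exp_add_mult,
       simp only: mult_ac)
qed (simp add: bernpoly_fps_zero)

text \<open>Only \<open>B_1\<close> takes different values at 0 and 1. This is the source of the
  jump of the Bernoulli functions at the integers.\<close>

lemma bernpoly_fps_one: "bernpoly_fps c 1 = bernpoly_fps c 0 + fps_const c * fps_X"
proof (cases "c = 0")
  case False
  then show ?thesis
    by (rule fps_exp_minus_1_cancel)
      (simp only: bernpoly_fps_mult_exp distrib_right, simp add: algebra_simps)
qed (simp add: bernpoly_fps_zero)

text \<open>Multiply numerator and denominator of \<open>c t exp(c x t) / (exp(c t) - 1)\<close> by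
  \<open>exp(- c t)\<close>.\<close>

lemma bernpoly_fps_reflect: "bernpoly_fps (- c) (1 - x) = bernpoly_fps c x"
proof (cases "c = 0")
  case False
  have e: "fps_exp c * fps_exp (- c) = (1 :: real fps)"
    by (simp flip: fps_exp_add_mult)
  show ?thesis
  proof (rule fps_exp_minus_1_cancel[OF False])
    have "bernpoly_fps (- c) (1 - x) * (fps_exp c - 1)
        = - fps_exp c * (bernpoly_fps (- c) (1 - x) * (fps_exp (- c) - 1))"
      using e by algebra
    also have "\<dots> = fps_const c * fps_X * (fps_exp c * fps_exp (- c * (1 - x)))"
      by (simp only: bernpoly_fps_mult_exp fps_const_neg[symmetric]) (simp add: mult_ac flip: fps_const_neg)
    also have "fps_exp c * fps_exp (- c * (1 - x)) = fps_exp (c * x)"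
      by (simp flip: fps_exp_add_mult add: algebra_simps)
    finally show "bernpoly_fps (- c) (1 - x) * (fps_exp c - 1) = bernpoly_fps c x * (fps_exp c - 1)"
      by (simp add: bernpoly_fps_mult_exp)
  qed
qed (simp add: bernpoly_fps_zero)

lemma bernpoly_one_zero: "bernpoly 1 0 = - 1 / 2"
proof -
  \<comment> \<open>At \<open>x = 0\<close> the product is \<open>t\<close>, so its coefficient at
    \<open>t^2\<close>, which is \<open>B_1(0) + B_0(0) / 2\<close>, vanishes.\<close>
  have "fps_nth (bernpoly_fps 1 0 * (fps_exp 1 - 1)) 2 = 0"
    unfolding bernpoly_fps_mult_exp by (simp add: numeral_2_eq_2)
  then show ?thesis
    by (simp add: fps_mult_nth bernpoly_fps_def bernpoly_zero numeral_2_eq_2)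
qed

lemma bernpoly_one: "bernpoly 1 x = x - 1 / 2"
proof -
  have "fps_nth (bernpoly_fps 1 (0 + x)) 1 = x - 1 / 2"
    unfolding bernpoly_fps_shift fps_mult_nth_1
    using bernpoly_one_zero by (simp add: bernpoly_fps_def bernpoly_zero)
  then show ?thesis by (simp add: bernpoly_fps_def)
qed

section \<open>Generating functions of Bernoulli functions: reflection, period and jumps\<close>

text \<open>At an integer \<open>bernfun 1\<close> is 0 instead of \<open>B_1(0) = -1/2\<close>, so
  the coefficient of \<open>t\<close> is raised by \<open>c / 2\<close>: the series there is the
  mean of its two one-sided limits.\<close>

lemma bernfps_eq:
  "bernfps c x = bernpoly_fps c (frac x) + fps_const (delta_Ints x * c / 2) * fps_X"
proof (rule fps_ext)
  fix n
  show "fps_nth (bernfps c x) n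
      = fps_nth (bernpoly_fps c (frac x) + fps_const (delta_Ints x * c / 2) * fps_X) n"
    using bernpoly_one[of "frac x"] frac_eq_0_iff[of x]
    by (cases "n = 1")
      (auto simp: bernfps_def bernpoly_fps_def bernfun_def delta_Ints_def bernpoly_zero simp del: frac_eq_0_iff)
qed

text \<open>Off the integers \<open>frac (- x) = 1 - frac x\<close>, and the reflection of the
  polynomials applies. At an integer the mean value is what makes both sides agree: of the
  difference \<open>c t\<close> between the endpoints 0 and 1, each side absorbs one half.\<close>

lemma bernfps_reflect: "bernfps (- c) (- x) = bernfps c x"
proof (cases "x \<in> \<int>")
  case True
  have "bernpoly_fps (- c) 0 = bernpoly_fps (- c) 1 + fps_const c * fps_X"
    by (simp add: bernpoly_fps_one flip: fps_const_neg)
  also have "bernpoly_fps (- c) 1 = bernpoly_fps c 0"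
    using bernpoly_fps_reflect[of c 0] by simp
  also have "fps_const c * fps_X = fps_const (c / 2) * fps_X + fps_const (c / 2) * fps_X"
    by (simp only: distrib_right[symmetric] fps_const_add) simp
  finally have eq: "bernpoly_fps (- c) 0
      = bernpoly_fps c 0 + (fps_const (c / 2) * fps_X + fps_const (c / 2) * fps_X)" .
  have "frac x = 0" "frac (- x) = 0" "delta_Ints x = 1" "delta_Ints (- x) = 1"
    using True by (simp_all add: delta_Ints_def)
  then have "bernfps (- c) (- x) = bernpoly_fps (- c) 0 + fps_const (- (c / 2)) * fps_X"
    "bernfps c x = bernpoly_fps c 0 + fps_const (c / 2) * fps_X"
    by (simp_all only: bernfps_eq) simp_all
  then show ?thesis
    unfolding eq by (simp flip: fps_const_neg)
next
  case False
  then show ?thesis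
    by (simp add: bernfps_eq delta_Ints_def frac_neg bernpoly_fps_reflect)
qed

lemma bernfps_add_int: "k \<in> \<int> \<Longrightarrow> bernfps c (x + k) = bernfps c x"
  by (auto simp: bernfps_eq delta_Ints_def frac_def elim!: Ints_cases)

text \<open>Just right of an integer the fractional part is \<open>h\<close>, just left of it
  \<open>1 + h\<close>; the value at the integer lies halfway, so both sides miss it by
  \<open>c t / 2\<close>, with opposite signs. The second conjunct later makes the delta term vanish
  at nearby points.\<close>

lemma bernfps_eventually:
  "\<forall>\<^sub>F h in at 0. bernfps c (x + h) =
     fps_exp (c * h) * (bernfps c x - fps_const (sgn h * delta_Ints x * c / 2) * fps_X)
     \<and> delta_Ints (x + h) = 0"
proof (cases "x \<in> \<int>")
  case True
  then obtain k where k: "x = of_int k" by (elim Ints_cases)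
  have fr: "frac x = 0" using True by simp
  have "\<forall>\<^sub>F h in at 0. h \<in> {-1<..<1} - {0 :: real}"
    by (rule eventually_at_in_open) auto
  then show ?thesis
  proof eventually_elim
    case (elim h)
    then consider "0 < h" "h < 1" | "-1 < h" "h < 0" by fastforce
    then show ?case
    proof cases
      case 1
      then have fl: "\<lfloor>x + h\<rfloor> = k"
        unfolding k by linarith
      then have "frac (x + h) = 0 + h" "x + h \<notin> \<int>"
        using 1 by (auto simp: k frac_def elim!: Ints_cases)
      then show ?thesis
        using True 1 by (simp only: bernfps_eq fr bernpoly_fps_shift) (simp add: delta_Ints_def)
    next
      case 2
      then have fl: "\<lfloor>x + h\<rfloor> = k - 1"
        unfolding k by linarith
      then have "frac (x + h) = 1 + h" "x + h \<notin> \<int>"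
        using 2 by (auto simp: k frac_def elim!: Ints_cases)
      \<comment> \<open>Expansion around the endpoint 1 contributes a full \<open>c t\<close>; half
        of it is already part of the mean value, the other half is the jump.\<close>
      then have "bernfps c (x + h) = fps_exp (c * h) * (bernpoly_fps c 0 + fps_const c * fps_X)"
        by (simp only: bernfps_eq bernpoly_fps_shift bernpoly_fps_one) (simp add: delta_Ints_def)
      moreover have "fps_const (sgn h * delta_Ints x * c / 2) = - fps_const (c / 2)"
        using True 2 by (simp add: delta_Ints_def)
      moreover have "bernfps c x = bernpoly_fps c 0 + fps_const (c / 2) * fps_X"
        using True by (simp add: bernfps_eq fr delta_Ints_def)
      moreover have "fps_const c * fps_X = fps_const (c / 2) * fps_X + fps_const (c / 2) * fps_X"
        by (simp only: distrib_right[symmetric] fps_const_add) simp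
      ultimately have "bernfps c (x + h) =
          fps_exp (c * h) * (bernfps c x - fps_const (sgn h * delta_Ints x * c / 2) * fps_X)"
        by (simp only: minus_mult_left[symmetric] diff_minus_eq_add add.assoc)
      then show ?thesis
        using \<open>x + h \<notin> \<int>\<close> by (simp add: delta_Ints_def)
    qed
  qed
next
  case False
  then have fr: "0 < frac x" "frac x < 1"
    by (auto simp: frac_gt_0_iff frac_lt_1)
  then have "\<forall>\<^sub>F h in at 0. h \<in> {- frac x<..<1 - frac x} - {0 :: real}"
    by (intro eventually_at_in_open) auto
  then show ?thesis
  proof eventually_elim
    case (elim h)
    then have fl: "\<lfloor>x + h\<rfloor> = \<lfloor>x\<rfloor>"
      by (auto simp: frac_def floor_eq_iff)
    have "frac (x + h) = frac x + h"
      using fl by (simp add: frac_def)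
    moreover from this have "x + h \<notin> \<int>"
      using elim by (auto simp flip: frac_eq_0_iff)
    ultimately show ?case
      using False by (simp add: bernfps_eq bernpoly_fps_shift delta_Ints_def)
  qed
qed

section \<open>Jumps of the sums over \<open>l\<close> and of affine arguments\<close>

text \<open>If \<open>b x + z\<close> is an integer \<open>N\<close>, then the argument of index
  \<open>l\<close> is \<open>(N + l) / b\<close>, an integer for exactly one \<open>l\<close> in the
  range; for this \<open>l\<close>, \<open>(l + z) / b\<close> is congruent to \<open>- x\<close>
  modulo 1, so the periodic \<open>f\<close> has the value \<open>f (- x)\<close>. Otherwise no
  argument is an integer.\<close>

lemma sum_delta_Ints:
  fixes f :: "real \<Rightarrow> real fps" and b :: int and x z :: real
  assumes b: "b \<noteq> 0" and f: "\<And>t k. f (t + of_int k) = f t"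
  shows "(\<Sum>l = 1..\<bar>b\<bar>. f ((of_int l + z) / b) * fps_const (delta_Ints (x + (of_int l + z) / b)))
    = fps_const (delta_Ints (of_int b * x + z)) * f (- x)"
proof (cases "of_int b * x + z \<in> \<int>")
  case True
  then obtain N where N: "of_int b * x + z = of_int N" by (elim Ints_cases)
  have Ints_iff: "x + (of_int l + z) / b \<in> \<int> \<longleftrightarrow> b dvd N + l" for l
  proof -
    have "real_of_int (N + l) = of_int b * x + z + of_int l"
      using N by simp
    moreover have "x + (of_int l + z) / b = (of_int b * x + z + of_int l) / b"
      using b by (simp add: add_divide_distrib)
    ultimately have "x + (of_int l + z) / b = of_int (N + l) / of_int b"
      by (simp only:)
    also have "\<dots> \<in> \<int> \<longleftrightarrow> b dvd N + l"
      using b of_int_div_of_int_in_Ints_iff[of "N + l" b, where ?'a = real] by simp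
    finally show ?thesis .
  qed
  \<comment> \<open>The representative of \<open>- N\<close> modulo \<open>\<bar>b\<bar>\<close> in
    the range from 1; it is \<open>\<bar>b\<bar>\<close>, not 0, when \<open>b\<close> divides
    \<open>N\<close>.\<close>
  define l0 where "l0 = \<bar>b\<bar> - N mod \<bar>b\<bar>"
  have l0: "l0 \<in> {1..\<bar>b\<bar>}"
    using b pos_mod_bound[of "\<bar>b\<bar>" N] pos_mod_sign[of "\<bar>b\<bar>" N]
    unfolding l0_def atLeastAtMost_iff by linarith
  have "N + l0 = (N - N mod \<bar>b\<bar>) + \<bar>b\<bar>"
    by (simp add: l0_def)
  moreover have "\<bar>b\<bar> dvd (N - N mod \<bar>b\<bar>) + \<bar>b\<bar>"
    by (intro dvd_add dvd_minus_mod dvd_refl)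
  ultimately have "\<bar>b\<bar> dvd N + l0"
    by (simp only:)
  then have dvd0: "b dvd N + l0"
    by simp
  have uniq: "l = l0" if "l \<in> {1..\<bar>b\<bar>}" "b dvd N + l" for l
  proof -
    have "b dvd l - l0"
      using dvd_diff[OF that(2) dvd0] by simp
    moreover have "\<bar>l - l0\<bar> < \<bar>b\<bar>"
      using that(1) l0 by auto
    ultimately show ?thesis
      using dvd_imp_le_int[of "l - l0" b] by (cases "l = l0") auto
  qed
  have "(\<Sum>l = 1..\<bar>b\<bar>. f ((of_int l + z) / b) * fps_const (delta_Ints (x + (of_int l + z) / b)))
    = (\<Sum>l = 1..\<bar>b\<bar>. if l = l0 then f ((of_int l0 + z) / b) else 0)"
  proof (rule sum.cong)
    fix l assume "l \<in> {1..\<bar>b\<bar>}"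
    with uniq[of l] dvd0 have "b dvd N + l \<longleftrightarrow> l = l0" by blast
    then show "f ((of_int l + z) / b) * fps_const (delta_Ints (x + (of_int l + z) / b))
        = (if l = l0 then f ((of_int l0 + z) / b) else 0)"
      using Ints_iff[of l] by (simp add: delta_Ints_def)
  qed simp
  also have "\<dots> = f ((of_int l0 + z) / b)"
    using l0 by simp
  also have "\<dots> = f (- x)"
  proof -
    have "x + (of_int l0 + z) / b \<in> \<int>"
      using dvd0 Ints_iff[of l0] by simp
    then obtain k where k: "x + (of_int l0 + z) / b = of_int k"
      by (elim Ints_cases)
    then have "(of_int l0 + z) / b = - x + of_int k" by linarith
    then show ?thesis by (simp only: f)
  qed
  finally show ?thesis
    using True by (simp add: delta_Ints_def)
next
  case False
  have "x + (of_int l + z) / b \<notin> \<int>" for l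
  proof
    assume "x + (of_int l + z) / b \<in> \<int>"
    then obtain k where "x + (of_int l + z) / b = of_int k" by (elim Ints_cases)
    moreover have "of_int b * (x + (of_int l + z) / b) = of_int b * x + (of_int l + z)"
      using b by (simp only: distrib_left[of _ x]) simp
    ultimately have "of_int b * x + z = of_int (b * k - l)"
      by simp
    then have "of_int b * x + z \<in> \<int>"
      by (simp only: Ints_of_int)
    with False show False by contradiction
  qed
  then show ?thesis
    using False by (simp add: delta_Ints_def)
qed

text \<open>At most one summand jumps, and its weight is \<open>f (- x)\<close>. For the
  \<open>f\<close> used later, reflection turns \<open>f (- x)\<close> into a factor of the product
  on the left of the theorem.\<close>

lemma bernfps_sum_eventually:
  fixes f :: "real \<Rightarrow> real fps" and b :: int and x z :: real
  assumes b: "b \<noteq> 0" and f: "\<And>t k. f (t + of_int k) = f t"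
  shows "\<forall>\<^sub>F h in at 0.
    (\<Sum>l = 1..\<bar>b\<bar>. f ((of_int l + z) / b) * bernfps w (x + h + (of_int l + z) / b))
    = fps_exp (w * h) *
      ((\<Sum>l = 1..\<bar>b\<bar>. f ((of_int l + z) / b) * bernfps w (x + (of_int l + z) / b))
       - fps_const (sgn h * w / 2) * fps_X * fps_const (delta_Ints (of_int b * x + z)) * f (- x))"
proof -
  \<comment> \<open>The sum is finite, so one punctured neighbourhood serves all
    \<open>l\<close>.\<close>
  have "\<forall>\<^sub>F h in at 0. \<forall>l\<in>{1..\<bar>b\<bar>}. bernfps w (x + (of_int l + z) / b + h) =
      fps_exp (w * h) * (bernfps w (x + (of_int l + z) / b)
        - fps_const (sgn h * delta_Ints (x + (of_int l + z) / b) * w / 2) * fps_X)"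
  proof (rule eventually_ball_finite)
    show "\<forall>l\<in>{1..\<bar>b\<bar>}. \<forall>\<^sub>F h in at 0. bernfps w (x + (of_int l + z) / b + h) =
      fps_exp (w * h) * (bernfps w (x + (of_int l + z) / b)
        - fps_const (sgn h * delta_Ints (x + (of_int l + z) / b) * w / 2) * fps_X)"
      by (intro ballI eventually_mono[OF bernfps_eventually]) (erule conjunct1)
  qed simp
  then show ?thesis
  proof eventually_elim
    case (elim h)
    have "(\<Sum>l = 1..\<bar>b\<bar>. f ((of_int l + z) / b) * bernfps w (x + h + (of_int l + z) / b))
      = (\<Sum>l = 1..\<bar>b\<bar>. fps_exp (w * h) * (f ((of_int l + z) / b) * bernfps w (x + (of_int l + z) / b)
         - fps_const (sgn h * w / 2) * fps_X *
           (f ((of_int l + z) / b) * fps_const (delta_Ints (x + (of_int l + z) / b)))))"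
    proof (rule sum.cong)
      fix l assume l: "l \<in> {1..\<bar>b\<bar>}"
      have eq: "fps_const (sgn h * delta_Ints (x + (of_int l + z) / b) * w / 2)
        = fps_const (sgn h * w / 2) * fps_const (delta_Ints (x + (of_int l + z) / b))"
        by (simp add: mult_ac)
      have "bernfps w (x + h + (of_int l + z) / b) =
      fps_exp (w * h) * (bernfps w (x + (of_int l + z) / b)
        - fps_const (sgn h * delta_Ints (x + (of_int l + z) / b) * w / 2) * fps_X)"
        using elim l by (simp add: add_ac)
      then show "f ((of_int l + z) / b) * bernfps w (x + h + (of_int l + z) / b)
        = fps_exp (w * h) * (f ((of_int l + z) / b) * bernfps w (x + (of_int l + z) / b)
         - fps_const (sgn h * w / 2) * fps_X *
           (f ((of_int l + z) / b) * fps_const (delta_Ints (x + (of_int l + z) / b))))"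
        unfolding eq by (simp only: right_diff_distrib mult_ac)
    qed simp
    also have "\<dots> = fps_exp (w * h) *
      ((\<Sum>l = 1..\<bar>b\<bar>. f ((of_int l + z) / b) * bernfps w (x + (of_int l + z) / b))
       - fps_const (sgn h * w / 2) * fps_X *
         (\<Sum>l = 1..\<bar>b\<bar>. f ((of_int l + z) / b) * fps_const (delta_Ints (x + (of_int l + z) / b))))"
      by (simp only: sum_subtractf flip: sum_distrib_left)
    also have "\<dots> = fps_exp (w * h) *
      ((\<Sum>l = 1..\<bar>b\<bar>. f ((of_int l + z) / b) * bernfps w (x + (of_int l + z) / b))
       - fps_const (sgn h * w / 2) * fps_X * fps_const (delta_Ints (of_int b * x + z)) * f (- x))"
      using sum_delta_Ints[where f = f and x = x and z = z, OF b f] by (simp only: mult.assoc)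
    finally show ?case .
  qed
qed

text \<open>Use the jump formula with \<open>a * h\<close> as increment; a negative \<open>a\<close>
  swaps the two sides, whence the factor \<open>sgn a\<close>.\<close>

lemma bernfps_affine_eventually:
  fixes a x y c :: real
  assumes "a \<noteq> 0"
  shows "\<forall>\<^sub>F h in at 0. bernfps c (a * (x + h) + y) =
     fps_exp (c * a * h) *
       (bernfps c (a * x + y) - fps_const (sgn h * sgn a * delta_Ints (a * x + y) * c / 2) * fps_X)
     \<and> delta_Ints (a * (x + h) + y) = 0"
proof -
  have "filterlim (\<lambda>h. a * h) (at 0) (at 0)"
    using assms by (auto simp: filterlim_at eventually_at_filter intro!: tendsto_eq_intros)
  from eventually_compose_filterlim[OF bernfps_eventually this, of c "a * x + y"] show ?thesis
    by eventually_elim (simp add: algebra_simps sgn_mult)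
qed

section \<open>The identity between generating functions\<close>

text \<open>After removal of the exponential the function is locally constant, meaning equality near
  each point, so no topology on power series enters. Comparison of \<open>x\<close> with
  \<open>x + 1\<close> gives \<open>f x = exp(- w t) f x\<close>, and \<open>exp(- w t)\<close> is
  not 1.\<close>

lemma periodic_exp_eq_0:
  fixes f :: "real \<Rightarrow> real fps"
  assumes w: "w \<noteq> 0"
    and local: "\<And>x. \<forall>\<^sub>F h in at 0. f (x + h) = fps_exp (w * h) * f x"
    and periodic: "\<And>x. f (x + 1) = f x"
  shows "f x = 0"
proof -
  define g where "g t = fps_exp (- w * t) * f t" for t
  have "g x = g (x + 1)"
  proof (rule connected_local_const[OF connected_UNIV])
    show "\<forall>t\<in>UNIV. \<forall>\<^sub>F t' in at t. g t = g t'"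
    proof
      fix t
      from local[of t] have "\<forall>\<^sub>F h in at 0. g t = g (h + t)"
      proof eventually_elim
        case (elim h)
        have "fps_exp (- w * (h + t)) * fps_exp (w * h) = fps_exp (- w * t)"
          by (simp add: algebra_simps flip: fps_exp_add_mult)
        then show ?case
          using elim by (simp only: g_def add.commute[of h t] mult.assoc[symmetric])
      qed
      then show "\<forall>\<^sub>F t' in at t. g t = g t'"
        by (subst at_to_0) (simp add: eventually_filtermap)
    qed
  qed auto
  moreover have "fps_exp (- w * (x + 1)) = fps_exp (- w * x) * fps_exp (- w)"
    by (simp add: distrib_left flip: fps_exp_add_mult)
  ultimately have "fps_exp (- w * x) * f x = fps_exp (- w * x) * (fps_exp (- w) * f x)"
    by (simp only: g_def periodic mult.assoc)
  then have "1 * f x = fps_exp (- w) * f x"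
    by simp
  then have "f x = 0 \<or> fps_exp (- w) = 1"
    unfolding mult_cancel_right by auto
  then show ?thesis
    using w by (simp only: fps_exp_eq_one_iff) simp
qed

text \<open>The theorem for all \<open>m\<close> and \<open>n\<close> at once, in two parameters
  \<open>u\<close> and \<open>v\<close> that separate the degrees of the two Bernoulli
  functions.\<close>

lemma bernfps_identity:
  fixes a b :: int and u v w x y z :: real
  assumes a: "a \<noteq> 0" and b: "b \<noteq> 0"
    and w: "w = of_int a * u + of_int b * v" "w \<noteq> 0"
  shows "fps_const w * bernfps u (of_int a * x + y) * bernfps v (of_int b * x + z)
    = fps_const v * fps_const (of_int (sgn b)) *
        (\<Sum>l = 1..\<bar>b\<bar>. bernfps (- u) (of_int a * ((of_int l + z) / b) - y) *
          bernfps w (x + (of_int l + z) / b))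
    + fps_const u * fps_const (of_int (sgn a)) *
        (\<Sum>l = 1..\<bar>a\<bar>. bernfps (- v) (of_int b * ((of_int l + y) / a) - z) *
          bernfps w (x + (of_int l + y) / a))
    - fps_const (of_int (sgn a)) * fps_const (of_int (sgn b)) *
      fps_const (delta_Ints (of_int a * x + y)) * fps_const (delta_Ints (of_int b * x + z)) *
      fps_const u * fps_const v * fps_const w * fps_const (1 / 2) ^ 2 * fps_X ^ 2"
proof -
  define f1 where "f1 t = bernfps (- u) (of_int a * t - y)" for t
  define f2 where "f2 t = bernfps (- v) (of_int b * t - z)" for t
  define P where "P t = bernfps u (of_int a * t + y)" for t
  define Q where "Q t = bernfps v (of_int b * t + z)" for t
  define d1 where "d1 t = delta_Ints (of_int a * t + y)" for t
  define d2 where "d2 t = delta_Ints (of_int b * t + z)" for t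
  define S1 where "S1 t = (\<Sum>l = 1..\<bar>b\<bar>. f1 ((of_int l + z) / b) * bernfps w (t + (of_int l + z) / b))" for t
  define S2 where "S2 t = (\<Sum>l = 1..\<bar>a\<bar>. f2 ((of_int l + y) / a) * bernfps w (t + (of_int l + y) / a))" for t
  define U where "U = fps_const u"
  define V where "V = fps_const v"
  define W where "W = fps_const w"
  define A where "A = fps_const (real_of_int (sgn a))"
  define B where "B = fps_const (real_of_int (sgn b))"
  define q where "q = fps_const (1 / 2 :: real)"
  note const_defs = U_def V_def W_def A_def B_def q_def
  \<comment> \<open>In \<open>W * P * Q\<close> the terms linear in the jumps cancel against the
    jumps of \<open>S1\<close> and \<open>S2\<close>. The product of both jumps remains at
    \<open>t + h\<close>, where the delta term is 0; it equals the delta term at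
    \<open>t\<close>.\<close>
  define D where "D t = W * P t * Q t - V * B * S1 t - U * A * S2 t
    + A * B * fps_const (d1 t) * fps_const (d2 t) * U * V * W * q ^ 2 * fps_X ^ 2" for t
  have f1: "f1 (t + of_int k) = f1 t" and f2: "f2 (t + of_int k) = f2 t" for t k
    using bernfps_add_int[of "of_int (a * k)" "- u" "of_int a * t - y"]
      bernfps_add_int[of "of_int (b * k)" "- v" "of_int b * t - z"]
    by (simp_all add: f1_def f2_def algebra_simps)
  \<comment> \<open>The parameters \<open>- u\<close> and \<open>- v\<close> in the sums are chosen
    for this reflection; they produce the signs \<open>(-1) ^ j\<close> of the theorem.\<close>
  have f1_neg: "f1 (- t) = P t" and f2_neg: "f2 (- t) = Q t" for t
  proof -
    have "of_int a * (- t) - y = - (of_int a * t + y)" "of_int b * (- t) - z = - (of_int b * t + z)"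
      by simp_all
    then show "f1 (- t) = P t" "f2 (- t) = Q t"
      unfolding f1_def f2_def P_def Q_def by (simp_all only: bernfps_reflect)
  qed
  have sgn_int: "sgn (real_of_int k) = real_of_int (sgn k)" for k
    by (simp add: sgn_if)
  have "D x = 0"
  proof (rule periodic_exp_eq_0[OF w(2)])
    fix t
    have P: "\<forall>\<^sub>F h in at 0. P (t + h) = fps_exp (u * of_int a * h) *
        (P t - fps_const (sgn h * sgn (of_int a) * d1 t * u / 2) * fps_X) \<and> d1 (t + h) = 0"
      unfolding P_def d1_def by (rule bernfps_affine_eventually) (use a in simp)
    have Q: "\<forall>\<^sub>F h in at 0. Q (t + h) = fps_exp (v * of_int b * h) *
        (Q t - fps_const (sgn h * sgn (of_int b) * d2 t * v / 2) * fps_X) \<and> d2 (t + h) = 0"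
      unfolding Q_def d2_def by (rule bernfps_affine_eventually) (use b in simp)
    have S1: "\<forall>\<^sub>F h in at 0. S1 (t + h) = fps_exp (w * h) *
        (S1 t - fps_const (sgn h * w / 2) * fps_X * fps_const (d2 t) * P t)"
      using bernfps_sum_eventually[where f = f1 and z = z and x = t and w = w, OF b f1]
      by (simp add: S1_def d2_def f1_neg)
    have S2: "\<forall>\<^sub>F h in at 0. S2 (t + h) = fps_exp (w * h) *
        (S2 t - fps_const (sgn h * w / 2) * fps_X * fps_const (d1 t) * Q t)"
      using bernfps_sum_eventually[where f = f2 and z = y and x = t and w = w, OF a f2]
      by (simp add: S2_def d1_def f2_neg)
    have "\<forall>\<^sub>F h in at 0. h \<noteq> (0 :: real)"
      by (simp add: eventually_at_filter)
    with P Q S1 S2 show "\<forall>\<^sub>F h in at 0. D (t + h) = fps_exp (w * h) * D t"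
    proof eventually_elim
      case (elim h)
      define s where "s = fps_const (sgn h)"
      \<comment> \<open>The product of the two jumps does not depend on the side from which the
        point is approached.\<close>
      have s: "s * s = 1"
        using elim by (simp add: s_def sgn_if)
      have e: "fps_exp (u * of_int a * h) * fps_exp (v * of_int b * h) = fps_exp (w * h)"
        by (simp add: w(1) algebra_simps flip: fps_exp_add_mult)
      have P': "P (t + h) = fps_exp (u * of_int a * h) * (P t - s * A * fps_const (d1 t) * U * q * fps_X)"
        using elim by (simp add: s_def const_defs sgn_int)
      have Q': "Q (t + h) = fps_exp (v * of_int b * h) * (Q t - s * B * fps_const (d2 t) * V * q * fps_X)"
        using elim by (simp add: s_def const_defs sgn_int)
      have S1': "S1 (t + h) = fps_exp (w * h) * (S1 t - s * W * q * fps_X * fps_const (d2 t) * P t)"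
        using elim by (simp add: s_def const_defs)
      have S2': "S2 (t + h) = fps_exp (w * h) * (S2 t - s * W * q * fps_X * fps_const (d1 t) * Q t)"
        using elim by (simp add: s_def const_defs)
      have d: "fps_const (d1 (t + h)) = 0"
        using elim by simp
      \<comment> \<open>The cancellation as an identity in a commutative ring. The literal 0 stands
        for \<open>d1 (t + h)\<close>, and \<open>c'\<close> for \<open>d2 (t + h)\<close>.\<close>
      have ring: "W' * (e1 * (P' - s' * A' * c1 * U' * q' * X)) * (e2 * (Q' - s' * B' * c2 * V' * q' * X))
          - V' * B' * (e' * (T1 - s' * W' * q' * X * c2 * P'))
          - U' * A' * (e' * (T2 - s' * W' * q' * X * c1 * Q'))
          + A' * B' * 0 * c' * U' * V' * W' * q' ^ 2 * X ^ 2
        = e' * (W' * P' * Q' - V' * B' * T1 - U' * A' * T2 + A' * B' * c1 * c2 * U' * V' * W' * q' ^ 2 * X ^ 2)"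
        if "s' * s' = 1" "e1 * e2 = e'"
        for s' e1 e2 e' P' Q' T1 T2 A' B' U' V' W' q' c1 c2 c' X :: "real fps"
        using that by algebra
      show ?case
        unfolding D_def P' Q' S1' S2' d by (rule ring[OF s e])
    qed
  next
    fix t
    have per: "bernfps w (t + 1 + r) = bernfps w (t + r)" for r
      using bernfps_add_int[of 1 w "t + r"] by (simp add: algebra_simps)
    have shift: "delta_Ints (r + of_int k) = delta_Ints r" for r k
      by (simp add: delta_Ints_def)
    have "P (t + 1) = P t" "Q (t + 1) = Q t"
      using bernfps_add_int[of "of_int a" u "of_int a * t + y"] bernfps_add_int[of "of_int b" v "of_int b * t + z"]
      by (simp_all add: P_def Q_def algebra_simps)
    moreover have "S1 (t + 1) = S1 t" "S2 (t + 1) = S2 t"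
      by (simp_all only: S1_def S2_def per)
    moreover have "d1 (t + 1) = d1 t" "d2 (t + 1) = d2 t"
      using shift[of "of_int a * t + y" a] shift[of "of_int b * t + z" b]
      by (simp_all add: d1_def d2_def algebra_simps)
    ultimately show "D (t + 1) = D t"
      by (simp add: D_def)
  qed
  moreover have "p = q + r - k" if "p - q - r + k = 0" for p q r k :: "real fps"
    using that by algebra
  ultimately show ?thesis
    unfolding D_def P_def Q_def S1_def S2_def d1_def d2_def f1_def f2_def const_defs by blast
qed

section \<open>Extraction of coefficients\<close>

text \<open>For \<open>v = 1\<close> the polynomial is the coefficient of \<open>t^(m+n)\<close> in
  a product of series with parameters \<open>- u\<close> and \<open>a u + b\<close>, read as a
  polynomial in \<open>u\<close>. The monomial supplies \<open>u^j\<close>, the binomial theorem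
  supplies \<open>u^(m-j)\<close>, and the factorials combine to \<open>m choose j\<close>. Here
  \<open>n\<close> is one less than in the theorem.\<close>

lemma coeff_linear_power_monom_sum:
  fixes F G :: "nat \<Rightarrow> real" and a b :: real
  shows "fact m * fact (Suc n) *
      coeff (\<Sum>j = 0..m + n. monom (F j / fact j * (-1) ^ j * (G (m + n - j) / fact (m + n - j))) j
        * [:b, a:] ^ (m + n - j)) m
    = real (Suc n) * b ^ n *
      (\<Sum>j = 0..m. real (m choose j) * (-1) ^ j * a ^ (m - j) * (F j * G (m + n - j)))"
proof -
  have coeff_eq: "coeff (\<Sum>j = 0..m + n. monom (F j / fact j * (-1) ^ j * (G (m + n - j) / fact (m + n - j))) j
        * [:b, a:] ^ (m + n - j)) m
    = (\<Sum>j = 0..m. F j / fact j * (-1) ^ j * (G (m + n - j) / fact (m + n - j)) *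
        (real (m + n - j choose (m - j)) * a ^ (m - j) * b ^ n))"
    unfolding coeff_sum
  proof (rule sum.mono_neutral_cong_right)
    fix j assume "j \<in> {0..m}"
    then have "m - j \<le> m + n - j" "m + n - j - (m - j) = n" "\<not> m < j" by auto
    then show "coeff (monom (F j / fact j * (-1) ^ j * (G (m + n - j) / fact (m + n - j))) j
        * [:b, a:] ^ (m + n - j)) m
      = F j / fact j * (-1) ^ j * (G (m + n - j) / fact (m + n - j)) *
        (real (m + n - j choose (m - j)) * a ^ (m - j) * b ^ n)"
      by (simp only: coeff_monom_mult coeff_linear_poly_power if_False)
  qed (auto simp: coeff_monom_mult)
  show ?thesis
    unfolding coeff_eq sum_distrib_left
  proof (rule sum.cong)
    fix j assume "j \<in> {0..m}"
    then have j: "j \<le> m" by simp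
    have e1: "real (m + n - j choose (m - j)) = fact (m + n - j) / (fact (m - j) * fact n)"
      using j by (subst binomial_fact) auto
    have e2: "real (m choose j) = fact m / (fact j * fact (m - j))"
      using j by (rule binomial_fact)
    show "fact m * fact (Suc n) * (F j / fact j * (-1) ^ j *
        (G (m + n - j) / fact (m + n - j)) * (real (m + n - j choose (m - j)) * a ^ (m - j) * b ^ n))
      = real (Suc n) * b ^ n * (real (m choose j) * (-1) ^ j * a ^ (m - j) * (F j * G (m + n - j)))"
      unfolding e1 e2 by (simp add: divide_simps)
  qed simp
qed

text \<open>The counterpart for the second sum. Its first series has parameter \<open>-1\<close>, so
  all of \<open>u^m\<close> comes from the power of \<open>a u + b\<close>; for \<open>j > n\<close>
  the degree of that power is below \<open>m\<close>. Here \<open>m\<close> is one less than in the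
  theorem, because the outer factor \<open>u\<close> takes up one degree.\<close>

lemma coeff_linear_power_smult_sum:
  fixes F G :: "nat \<Rightarrow> real" and a b :: real
  shows "fact (Suc m) * fact n *
      coeff (\<Sum>j = 0..m + n. smult (F j / fact j * (-1) ^ j * (G (m + n - j) / fact (m + n - j)))
        ([:b, a:] ^ (m + n - j))) m
    = real (Suc m) * a ^ m *
      (\<Sum>j = 0..n. real (n choose j) * (-1) ^ j * b ^ (n - j) * (F j * G (m + n - j)))"
proof -
  have coeff_eq: "coeff (\<Sum>j = 0..m + n. smult (F j / fact j * (-1) ^ j * (G (m + n - j) / fact (m + n - j)))
        ([:b, a:] ^ (m + n - j))) m
    = (\<Sum>j = 0..n. F j / fact j * (-1) ^ j * (G (m + n - j) / fact (m + n - j)) *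
        (real (m + n - j choose m) * a ^ m * b ^ (n - j)))"
    unfolding coeff_sum
  proof (rule sum.mono_neutral_cong_right)
    show "\<forall>j\<in>{0..m + n} - {0..n}. coeff (smult (F j / fact j * (-1) ^ j *
        (G (m + n - j) / fact (m + n - j))) ([:b, a:] ^ (m + n - j))) m = 0"
    proof
      fix j assume "j \<in> {0..m + n} - {0..n}"
      then have "m + n - j < m" by auto
      then have "coeff ([:b, a:] ^ (m + n - j)) m = 0"
        by (intro coeff_eq_0 le_less_trans[OF degree_power_le]) simp
      then show "coeff (smult (F j / fact j * (-1) ^ j *
        (G (m + n - j) / fact (m + n - j))) ([:b, a:] ^ (m + n - j))) m = 0"
        by simp
    qed
    fix j assume "j \<in> {0..n}"
    then have "m \<le> m + n - j" "m + n - j - m = n - j" by auto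
    then show "coeff (smult (F j / fact j * (-1) ^ j *
        (G (m + n - j) / fact (m + n - j))) ([:b, a:] ^ (m + n - j))) m
      = F j / fact j * (-1) ^ j * (G (m + n - j) / fact (m + n - j)) *
        (real (m + n - j choose m) * a ^ m * b ^ (n - j))"
      by (simp only: coeff_smult coeff_linear_poly_power)
  qed auto
  show ?thesis
    unfolding coeff_eq sum_distrib_left
  proof (rule sum.cong)
    fix j assume "j \<in> {0..n}"
    then have j: "j \<le> n" by simp
    have e1: "real (m + n - j choose m) = fact (m + n - j) / (fact m * fact (n - j))"
      using j by (subst binomial_fact) auto
    have e2: "real (n choose j) = fact n / (fact j * fact (n - j))"
      using j by (rule binomial_fact)
    show "fact (Suc m) * fact n * (F j / fact j * (-1) ^ j *
        (G (m + n - j) / fact (m + n - j)) * (real (m + n - j choose m) * a ^ m * b ^ (n - j)))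
      = real (Suc m) * a ^ m * (real (n choose j) * (-1) ^ j * b ^ (n - j) * (F j * G (m + n - j)))"
      unfolding e1 e2 by (simp add: divide_simps)
  qed simp
qed

text \<open>The product \<open>p * q\<close> vanishes at every real number, including the roots of
  \<open>q\<close>, hence is the zero polynomial.\<close>

lemma poly_eq_0_of_cofinite:
  fixes p q :: "real poly"
  assumes "q \<noteq> 0" and "\<And>s. poly q s \<noteq> 0 \<Longrightarrow> poly p s = 0"
  shows "p = 0"
proof -
  have "poly (p * q) = poly 0"
    using assms(2) by (auto simp: fun_eq_iff)
  then show ?thesis
    using assms(1) by (simp only: poly_eq_poly_eq_iff) simp
qed

lemma fps_nth_bernfps_mult:
  "fps_nth (bernfps c x * bernfps d y) N =
    (\<Sum>j = 0..N. bernfun j x / fact j * (bernfun (N - j) y / fact (N - j)) * (c ^ j * d ^ (N - j)))"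
  unfolding fps_mult_nth bernfps_def by (rule sum.cong) simp_all

text \<open>The theorem with \<open>Suc m\<close> and \<open>Suc n\<close> for its indices and with
  \<open>l\<close> as the outer summation variable, since each \<open>l\<close> gives a polynomial
  of its own. It is the coefficient of \<open>t^N u^(Suc m)\<close> at \<open>v = 1\<close>,
  multiplied by \<open>fact (Suc m) * fact (Suc n)\<close>.\<close>

lemma bernfun_identity_Suc:
  fixes m n :: nat and a b :: int and x y z :: real
  assumes a: "a \<noteq> 0" and b: "b \<noteq> 0"
  shows "real (Suc m) * real_of_int a * bernfun m (real_of_int a * x + y) * bernfun (Suc n) (real_of_int b * x + z)
     + real (Suc n) * real_of_int b * bernfun (Suc m) (real_of_int a * x + y) * bernfun n (real_of_int b * x + z)
     = real_of_int (sgn b) * (\<Sum>l = 1..\<bar>b\<bar>. real (Suc n) * real_of_int b ^ n *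
         (\<Sum>j = 0..Suc m. real (Suc m choose j) * (-1) ^ j * real_of_int a ^ (Suc m - j) *
              (bernfun j (real_of_int a * ((real_of_int l + z) / real_of_int b) - y) *
              bernfun (Suc m + n - j) (x + (real_of_int l + z) / real_of_int b))))
       + real_of_int (sgn a) * (\<Sum>l = 1..\<bar>a\<bar>. real (Suc m) * real_of_int a ^ m *
         (\<Sum>j = 0..Suc n. real (Suc n choose j) * (-1) ^ j * real_of_int b ^ (Suc n - j) *
              (bernfun j (real_of_int b * ((real_of_int l + y) / real_of_int a) - z) *
              bernfun (m + Suc n - j) (x + (real_of_int l + y) / real_of_int a))))
       - fact (Suc m) * fact (Suc n) * real_of_int (sgn a) * real_of_int (sgn b) *
         delta_Ints (real_of_int a * x + y) * delta_Ints (real_of_int b * x + z) *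
         (if m = 1 \<and> n = 0 then real_of_int a else if m = 0 \<and> n = 1 then real_of_int b else 0) / 4"
    (is "?lhs = of_int (sgn b) * (\<Sum>l = 1..\<bar>b\<bar>. ?T1 l) + of_int (sgn a) * (\<Sum>l = 1..\<bar>a\<bar>. ?T2 l) - ?delta")
proof -
  \<comment> \<open>This is \<open>w\<close> for \<open>v = 1\<close>, as a polynomial in
    \<open>u\<close>.\<close>
  define p where "p = [:real_of_int b, real_of_int a:]"
  define N where "N = Suc (m + n)"
  define B1 where "B1 j = bernfun j (of_int a * x + y)" for j
  define B2 where "B2 j = bernfun j (of_int b * x + z)" for j
  define F1 where "F1 l j = bernfun j (of_int a * ((of_int l + z) / b) - y)" for l j
  define F2 where "F2 l j = bernfun j (of_int b * ((of_int l + y) / a) - z)" for l j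
  define G1 where "G1 l j = bernfun j (x + (of_int l + z) / b)" for l j
  define G2 where "G2 l j = bernfun j (x + (of_int l + y) / a)" for l j
  define dd where "dd = of_int (sgn a) * of_int (sgn b) * delta_Ints (of_int a * x + y)
    * delta_Ints (of_int b * x + z) / 4"
  \<comment> \<open>\<open>L\<close>, \<open>R1 l\<close>, \<open>R2 l\<close> and \<open>K\<close>
    are the coefficients of \<open>t^N\<close> in the product, in the summands of both sums and in
    the delta term, as polynomials in \<open>u\<close>.\<close>
  define L where "L = p * (\<Sum>i = 0..N. monom (B1 i / fact i * (B2 (N - i) / fact (N - i))) i)"
  define R1 where "R1 l = (\<Sum>j = 0..N. monom (F1 l j / fact j * (-1) ^ j * (G1 l (N - j) / fact (N - j))) j
    * p ^ (N - j))" for l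
  define R2 where "R2 l = (\<Sum>j = 0..N. smult (F2 l j / fact j * (-1) ^ j * (G2 l (N - j) / fact (N - j)))
    (p ^ (N - j)))" for l
  \<comment> \<open>The delta term is a multiple of \<open>t^2\<close>, so it is seen only for
    \<open>N = 2\<close>; \<open>pCons 0 p\<close> is \<open>u w\<close>, and the 4 in
    \<open>dd\<close> is the square of the two halves.\<close>
  define K where "K = smult (if N = 2 then dd else 0) (pCons 0 p)"
  define R where "R = smult (of_int (sgn b)) (\<Sum>l = 1..\<bar>b\<bar>. R1 l)
    + smult (of_int (sgn a)) (pCons 0 (\<Sum>l = 1..\<bar>a\<bar>. R2 l)) - K"
  have "L - R = 0"
  proof (rule poly_eq_0_of_cofinite)
    show "p \<noteq> 0" using b by (simp add: p_def)
    \<comment> \<open>Only \<open>s = - b / a\<close> is excluded; elsewhere the identity of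
      generating functions applies with \<open>u = s\<close> and \<open>v = 1\<close>.\<close>
    fix s assume "poly p s \<noteq> 0"
    define w where "w = of_int a * s + of_int b * 1"
    have w: "w \<noteq> 0" "poly p s = w"
      using \<open>poly p s \<noteq> 0\<close> by (simp_all add: w_def p_def algebra_simps)
    have "fps_nth (fps_const w * bernfps s (of_int a * x + y) * bernfps 1 (of_int b * x + z)) N = poly L s"
      unfolding mult.assoc fps_mult_left_const_nth fps_nth_bernfps_mult L_def poly_mult w poly_sum poly_monom
      by (simp add: B1_def B2_def)
    moreover have "fps_nth (bernfps (- s) (of_int a * ((of_int l + z) / b) - y) * bernfps w (x + (of_int l + z) / b)) N
        = poly (R1 l) s" for l
      unfolding fps_nth_bernfps_mult R1_def poly_sum poly_mult poly_monom poly_power w F1_def G1_def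
      by (intro sum.cong) (simp_all add: power_minus[of s] mult_ac)
    moreover have "fps_nth (bernfps (- 1) (of_int b * ((of_int l + y) / a) - z) * bernfps w (x + (of_int l + y) / a)) N
        = poly (R2 l) s" for l
      unfolding fps_nth_bernfps_mult R2_def poly_sum poly_smult poly_power w F2_def G2_def
      by (intro sum.cong) (simp_all add: mult_ac)
    moreover have "fps_nth (fps_const (of_int (sgn a)) * fps_const (of_int (sgn b)) *
      fps_const (delta_Ints (of_int a * x + y)) * fps_const (delta_Ints (of_int b * x + z)) *
      fps_const s * fps_const 1 * fps_const w * fps_const (1 / 2) ^ 2 * fps_X ^ 2) N = poly K s"
      by (simp add: K_def dd_def w power2_eq_square) arith
    ultimately have "poly L s = poly R s"
      using arg_cong[OF bernfps_identity[OF a b w_def w(1), of x y z], of "\<lambda>f. fps_nth f N"]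
      by (simp add: R_def fps_sum_nth poly_sum mult.assoc)
    then show "poly (L - R) s = 0" by simp
  qed
  then have LR: "fact (Suc m) * fact (Suc n) * coeff L (Suc m) = fact (Suc m) * fact (Suc n) * coeff R (Suc m)"
    by simp
  have coeff_L: "fact (Suc m) * fact (Suc n) * coeff L (Suc m) = ?lhs"
  proof -
    define q where "q = (\<Sum>i = 0..N. monom (B1 i / fact i * (B2 (N - i) / fact (N - i))) i)"
    have coeff_q: "coeff q i = B1 i / fact i * (B2 (N - i) / fact (N - i))" if "i \<le> N" for i
      using that by (simp add: q_def coeff_sum)
    have "coeff L (Suc m) = of_int b * coeff q (Suc m) + of_int a * coeff q m"
      unfolding L_def q_def[symmetric] by (simp add: p_def)
    also have "coeff q (Suc m) = B1 (Suc m) / fact (Suc m) * (B2 n / fact n)"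
      by (subst coeff_q) (simp_all add: N_def)
    also have "coeff q m = B1 m / fact m * (B2 (Suc n) / fact (Suc n))"
      by (subst coeff_q) (simp_all add: N_def Suc_diff_le)
    finally have "fact (Suc m) * fact (Suc n) * coeff L (Suc m)
        = real (Suc n) * of_int b * B1 (Suc m) * B2 n + real (Suc m) * of_int a * B1 m * B2 (Suc n)"
      by (simp add: distrib_left del: of_nat_Suc)
    then show ?thesis
      by (simp add: B1_def B2_def)
  qed
  have coeff_R: "fact (Suc m) * fact (Suc n) * coeff R (Suc m)
     = of_int (sgn b) * (\<Sum>l = 1..\<bar>b\<bar>. fact (Suc m) * fact (Suc n) * coeff (R1 l) (Suc m))
     + of_int (sgn a) * (\<Sum>l = 1..\<bar>a\<bar>. fact (Suc m) * fact (Suc n) * coeff (R2 l) m)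
     - fact (Suc m) * fact (Suc n) * coeff K (Suc m)"
    unfolding R_def coeff_diff coeff_add coeff_smult coeff_pCons_Suc coeff_sum sum_distrib_left[symmetric]
    by (simp only: distrib_left right_diff_distrib mult_ac)
  have coeff_R1: "fact (Suc m) * fact (Suc n) * coeff (R1 l) (Suc m) = ?T1 l" for l
    using coeff_linear_power_monom_sum[of "Suc m" n "F1 l" "G1 l" "of_int b" "of_int a"]
    by (simp add: R1_def p_def N_def F1_def G1_def)
  have coeff_R2: "fact (Suc m) * fact (Suc n) * coeff (R2 l) m = ?T2 l" for l
    using coeff_linear_power_smult_sum[of m "Suc n" "F2 l" "G2 l" "of_int b" "of_int a"]
    by (simp add: R2_def p_def N_def F2_def G2_def)
  \<comment> \<open>In \<open>u (a u + b)\<close> the coefficient of \<open>u^2\<close> is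
    \<open>a\<close> and that of \<open>u\<close> is \<open>b\<close>; with \<open>N = 2\<close>
    these belong to \<open>(m, n) = (1, 0)\<close> and \<open>(0, 1)\<close>.\<close>
  have coeff_K: "fact (Suc m) * fact (Suc n) * coeff K (Suc m) = ?delta"
    by (auto simp: K_def N_def dd_def p_def coeff_pCons split: nat.splits)
  show ?thesis
    using LR unfolding coeff_L coeff_R coeff_R1 coeff_R2 coeff_K .
qed

theorem theorem3p3:
  fixes m n :: nat and a b :: int and x y z :: real
  assumes "m \<ge> 1" and "n \<ge> 1" and "a \<noteq> 0" and "b \<noteq> 0"
  shows
    "real m * real_of_int a * bernfun (m - 1) (real_of_int a * x + y) * bernfun n (real_of_int b * x + z)
     + real n * real_of_int b * bernfun m (real_of_int a * x + y) * bernfun (n - 1) (real_of_int b * x + z)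
     = real n * real_of_int b ^ (n - 1) * real_of_int (sgn b) *
         (\<Sum>j = 0..m. real (m choose j) * (-1) ^ j * real_of_int a ^ (m - j) *
           (\<Sum>l = 1..\<bar>b\<bar>.
              bernfun j (real_of_int a * (real_of_int l + z) / real_of_int b - y) *
              bernfun (m + n - j - 1) (x + (real_of_int l + z) / real_of_int b)))
       + real m * real_of_int a ^ (m - 1) * real_of_int (sgn a) *
         (\<Sum>j = 0..n. real (n choose j) * (-1) ^ j * real_of_int b ^ (n - j) *
           (\<Sum>l = 1..\<bar>a\<bar>.
              bernfun j (real_of_int b * (real_of_int l + y) / real_of_int a - z) *
              bernfun (m + n - j - 1) (x + (real_of_int l + y) / real_of_int a)))
       - real_of_int (sgn (a * b)) * delta_Ints (real_of_int a * x + y) * delta_Ints (real_of_int b * x + z) *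
         ((kronecker 1 (m - 1) * kronecker 1 n * real m * real_of_int a
           + kronecker 1 m * kronecker 1 (n - 1) * real n * real_of_int b) / 4)"
proof -
  from assms obtain m' n' where mn: "m = Suc m'" "n = Suc n'"
    by (metis Suc_le_D One_nat_def)
  \<comment> \<open>In both exceptional cases the product of factorials is 2, which is the factor
    \<open>m\<close> or \<open>n\<close> of the stated delta term.\<close>
  have delta: "fact (Suc m') * fact (Suc n') *
      (if m' = 1 \<and> n' = 0 then real_of_int a else if m' = 0 \<and> n' = 1 then real_of_int b else 0)
    = kronecker 1 m' * kronecker 1 (Suc n') * real (Suc m') * real_of_int a
      + kronecker 1 (Suc m') * kronecker 1 n' * real (Suc n') * real_of_int b"
    by (auto simp: kronecker_def)
  have sgn_ab: "real_of_int (sgn (a * b)) = of_int (sgn a) * of_int (sgn b)"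
    by (simp add: sgn_mult)
  \<comment> \<open>Moves the sum over \<open>l\<close> inside the sum over \<open>j\<close>, where
    the theorem has it.\<close>
  have swap: "c * s * (\<Sum>j = 0..k. g j * (\<Sum>l = 1..i. p j l * q j l))
      = s * (\<Sum>l = 1..i. c * (\<Sum>j = 0..k. g j * (p j l * q j l)))"
    for c s :: real and g :: "nat \<Rightarrow> real" and p q :: "nat \<Rightarrow> int \<Rightarrow> real" and k i
  proof -
    have "(\<Sum>j = 0..k. g j * (\<Sum>l = 1..i. p j l * q j l)) = (\<Sum>l = 1..i. \<Sum>j = 0..k. g j * (p j l * q j l))"
      unfolding sum_distrib_left by (rule sum.swap)
    then show ?thesis
      by (simp only: sum_distrib_left[symmetric] mult_ac)
  qed
  show ?thesis
    unfolding mn swap sgn_ab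
    using bernfun_identity_Suc[OF assms(3,4), of m' x y n' z] delta
    by (simp add: mult_ac)
qed

end
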